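(* Let $\lambda$ be an uncountable cardinal and suppose that $X\subseteq 2^\lambda$ (with the subspace topology inherited from the Tychonoff product $2^\lambda$) is $\mathrm{HFC}$ and that the closure in $X$ of every countable subset of $X$ is Menger. Then $X$ is a $D$-space.
   Context: For a finite partial function $s$ from $\lambda$ to $2$, $[s]=\{x\in 2^\lambda: x\supset s\}$ is the corresponding basic open subset of the Tychonoff product $2^\lambda$ ($2=\{0,1\}$ discrete). For $n<\omega$, $F\in[\lambda]^n$ (an $n$-element subset of $\lambda$) and $b\in 2^n$, $F*b$ denotes the function from $F$ to $2$ taking value $b(i)$ on the $i$-th element of $F$ (in increasing order). A subspace $X\subseteq 2^\lambda$ is called $\mathrm{HFC}$ if for every $n\in\omega$, every $b\in 2^n$ and every infinite family $\mathcal F\subseteq[\lambda]^n$ of pairwise disjoint sets, the set $X\setminus\bigcup\{[F*b]:F\in\mathcal F\}$ is countable. A space $Y$ is Menger if for every sequence $(\mathcal U_n)_{n\in\omega}$ of open covers of $Y$ there are finite $\mathcal V_n\subseteq\mathcal U_n$ such that $\bigcup_{n\in\omega}\mathcal V_n$ covers $Y$. A neighbourhood assignment on a topological space $X$ is a family $\{U_x:x\in X\}$ of open subsets of $X$ with $x\in U_x$ for every $x\in X$. A space $X$ is a $D$-space if for every neighbourhood assignment $\{U_x:x\in X\}$ there is a closed discrete set $D\subseteq X$ such that $\{U_x:x\in D\}$ covers $X$. *)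

theory Defs
  imports "HOL-Analysis.Analysis" "HOL-Library.Ramsey"
begin

(* A cardinal lambda is a well-order r with Card_order r; its elements are Field r, compared by r.
   The discrete space 2 is bool, with 0 = False and 1 = True. *)

definition two_cube :: "'l rel \<Rightarrow> ('l \<Rightarrow> bool) topology" where
  "two_cube r = product_topology (\<lambda>_. discrete_topology UNIV) (Field r)"

definition basic_open :: "'l rel \<Rightarrow> ('l \<rightharpoonup> bool) \<Rightarrow> ('l \<Rightarrow> bool) set" where
  "basic_open r s = {x \<in> topspace (two_cube r). \<forall>\<alpha> \<in> dom s. s \<alpha> = Some (x \<alpha>)}"

(* For alpha in F, the number of elements of F strictly below alpha is the position of alpha
   in the increasing enumeration of F, counted from 0. *)
definition star :: "'l rel \<Rightarrow> 'l set \<Rightarrow> (nat \<Rightarrow> bool) \<Rightarrow> ('l \<rightharpoonup> bool)" where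
  "star r F b = (\<lambda>\<alpha>. if \<alpha> \<in> F then Some (b (card (F \<inter> underS r \<alpha>))) else None)"

definition HFC :: "'l rel \<Rightarrow> ('l \<Rightarrow> bool) set \<Rightarrow> bool" where
  "HFC r X \<longleftrightarrow> X \<subseteq> topspace (two_cube r) \<and>
     (\<forall>n. \<forall>b \<in> {..<n} \<rightarrow>\<^sub>E UNIV. \<forall>\<F>. \<F> \<subseteq> nsets (Field r) n \<and> infinite \<F> \<and> pairwise disjnt \<F> \<longrightarrow>
        countable (X - (\<Union>F\<in>\<F>. basic_open r (star r F b))))"

definition Menger_space :: "'a topology \<Rightarrow> bool" where
  "Menger_space Y \<longleftrightarrow>
     (\<forall>\<U> :: nat \<Rightarrow> 'a set set.
        (\<forall>n. (\<forall>U \<in> \<U> n. openin Y U) \<and> \<Union>(\<U> n) = topspace Y) \<longrightarrow>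
        (\<exists>\<V>. (\<forall>n. finite (\<V> n) \<and> \<V> n \<subseteq> \<U> n) \<and> \<Union>(\<Union>n. \<V> n) = topspace Y))"

definition nbhd_assignment :: "'a topology \<Rightarrow> ('a \<Rightarrow> 'a set) \<Rightarrow> bool" where
  "nbhd_assignment X U \<longleftrightarrow> (\<forall>x \<in> topspace X. openin X (U x) \<and> x \<in> U x)"

definition D_space :: "'a topology \<Rightarrow> bool" where
  "D_space X \<longleftrightarrow>
     (\<forall>U. nbhd_assignment X U \<longrightarrow>
        (\<exists>D. closedin X D \<and> subtopology X D = discrete_topology D \<and> (\<Union>x\<in>D. U x) = topspace X))"

end

theory Submission
  imports Defs
begin

text \<open>
  Shrink the assignment to neighbourhoods \<open>{y \<in> X. y = x on F x}\<close> with \<open>F x\<close> finite, and close off under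
  countably many choices to get a countable \<open>A \<subseteq> X\<close> that behaves like the trace of a countable elementary
  submodel. By HFC, for every finite \<open>D \<subseteq> A\<close> the points of \<open>A\<close> outside the neighbourhoods of \<open>D\<close>
  have neighbourhoods covering the rest of \<open>X\<close>. Since the closure of \<open>A\<close> is
  Menger, the Menger game on it (in which the first player has no winning strategy, by Hurewicz) can be played
  with such finite \<open>D\<close>, as in Aurichi's proof that Menger spaces are D-spaces, and yields a closed discrete
  subset of \<open>A\<close> whose neighbourhoods cover the closure of \<open>A\<close>. If the plays also serve all types of points
  over \<open>A\<close> infinitely often, HFC shows that only countably many points of \<open>X\<close> remain, and these form a closed
  set that is treated greedily.
\<close>

section \<open>The Menger game\<close>

text \<open>Hurewicz's theorem that the first player has no winning strategy. The strategy is coded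
  by states \<open>s\<close> and increasing open covers \<open>G k s\<close>, so that a finite
  choice amounts to a single index, which \<open>nxt\<close> turns into the next state. The answers
  \<open>f\<close> are found before any state of the play is known.\<close>

lemma Menger_game:
  fixes G :: "nat \<Rightarrow> 's \<Rightarrow> nat \<Rightarrow> 'a set" and nxt :: "nat \<Rightarrow> 's \<Rightarrow> nat \<Rightarrow> 's"
  assumes Menger: "Menger_space Y"
    and init: "I s0"
    and step: "\<And>k s i. I s \<Longrightarrow> I (nxt k s i)"
    and opn: "\<And>k s i. I s \<Longrightarrow> openin Y (G k s i)"
    and mono: "\<And>k s i j. I s \<Longrightarrow> i \<le> j \<Longrightarrow> G k s i \<subseteq> G k s j"
    and cover: "\<And>k s. I s \<Longrightarrow> (\<Union>i. G k s i) = topspace Y"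
  shows "\<exists>st f. st 0 = s0 \<and> (\<forall>k. st (Suc k) = nxt k (st k) (f k)) \<and>
    (\<Union>k. G k (st k) (f k)) = topspace Y"
proof -
  define h where "h y k s = (LEAST i. y \<in> G k s i)" for y k s
  \<comment> \<open>\<open>R y k\<close> contains the \<open>k\<close>-th state of every play that \<open>y\<close> has survived; it is finite and locally
    bounded in \<open>y\<close>, so a single application of the Menger property defeats all \<open>y\<close>.\<close>
  define R where "R y = rec_nat {s0} (\<lambda>k S. \<Union>s\<in>S. nxt k s ` {..<h y k s})" for y
  have R0: "R y 0 = {s0}" and RSuc: "R y (Suc k) = (\<Union>s\<in>R y k. nxt k s ` {..<h y k s})" for y k
    by (simp_all add: R_def)
  have finR: "finite (R y k)" for y k
    by (induction k) (auto simp: R0 RSuc)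
  have IR: "I s" if "s \<in> R y k" for s y k
    using that by (induction k arbitrary: s) (auto simp: R0 RSuc init step)
  have h_in: "y \<in> G k s (h y k s)" if y: "y \<in> topspace Y" and s: "I s" for y k s
  proof -
    obtain i where "y \<in> G k s i"
      using cover[OF s, of k] y by blast
    then show ?thesis unfolding h_def by (rule LeastI)
  qed
  \<comment> \<open>The least capturing index is upper semicontinuous: on the open set
    \<open>G k s (h y k s)\<close> it is at most \<open>h y k s\<close>, and only the finitely many
    states in \<open>R y k\<close> have to be respected.\<close>
  have local: "\<exists>N. openin Y N \<and> y \<in> N \<and> (\<forall>y'\<in>N. R y' k \<subseteq> R y k)" if y: "y \<in> topspace Y" for y k
  proof (induction k)
    case 0
    show ?case using y by (auto simp: R0)
  next
    case (Suc k)
    then obtain N where N: "openin Y N" "y \<in> N" "\<forall>y'\<in>N. R y' k \<subseteq> R y k"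
      by (elim exE conjE) (rule that)
    define N' where "N' = N \<inter> ((\<Inter>s\<in>R y k. G k s (h y k s)) \<inter> topspace Y)"
    have "openin Y N'"
      unfolding N'_def by (intro openin_Int N openin_INT finR opn) (rule IR)
    moreover have "y \<in> N'"
      using y N(2) h_in[OF y] IR unfolding N'_def by blast
    moreover have "R y' (Suc k) \<subseteq> R y (Suc k)" if y': "y' \<in> N'" for y'
    proof -
      have sub: "R y' k \<subseteq> R y k" using N(3) y' unfolding N'_def by blast
      have "h y' k s \<le> h y k s" if "s \<in> R y' k" for s
        unfolding h_def[of y'] by (rule Least_le) (use that sub y' in \<open>auto simp: N'_def\<close>)
      then have "nxt k s ` {..<h y' k s} \<subseteq> nxt k s ` {..<h y k s}" if "s \<in> R y' k" for s
        using that by (intro image_mono) auto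
      then show ?thesis using sub unfolding RSuc by (intro UN_mono)
    qed
    ultimately show ?case by blast
  qed
  \<comment> \<open>These are the points that the answer \<open>m\<close> captures in round
    \<open>k\<close> from every state they can have survived to. Openness comes from
    \<open>local\<close>, the covering property from the finiteness of \<open>R y k\<close>.\<close>
  define Q where "Q k m = {y \<in> topspace Y. \<forall>s\<in>R y k. y \<in> G k s m}" for k m
  have Q_open: "openin Y (Q k m)" for k m
  proof (subst openin_subopen, intro ballI)
    fix y assume "y \<in> Q k m"
    then have y: "y \<in> topspace Y" "\<And>s. s \<in> R y k \<Longrightarrow> y \<in> G k s m" unfolding Q_def by blast+
    obtain N where N: "openin Y N" "y \<in> N" "\<forall>y'\<in>N. R y' k \<subseteq> R y k"
      using local[OF y(1), of k] by (elim exE conjE) (rule that)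
    let ?N = "N \<inter> ((\<Inter>s\<in>R y k. G k s m) \<inter> topspace Y)"
    have "openin Y ?N"
      by (intro openin_Int N openin_INT finR opn) (rule IR)
    moreover have "y \<in> ?N" using y N(2) by auto
    moreover have "?N \<subseteq> Q k m" using N(3) unfolding Q_def by blast
    ultimately show "\<exists>T. openin Y T \<and> y \<in> T \<and> T \<subseteq> Q k m" by blast
  qed
  have Q_mono: "Q k m \<subseteq> Q k m'" if "m \<le> m'" for k m m'
    unfolding Q_def using mono[OF IR that] by blast
  have Q_cover: "\<Union>(range (Q k)) = topspace Y" for k
  proof
    show "topspace Y \<subseteq> \<Union>(range (Q k))"
    proof
      fix y assume y: "y \<in> topspace Y"
      define m where "m = Max (insert 0 (h y k ` R y k))"
      have "y \<in> G k s m" if s: "s \<in> R y k" for s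
      proof -
        have "h y k s \<le> m" unfolding m_def by (rule Max_ge) (use finR s in auto)
        then show ?thesis using h_in[OF y IR[OF s]] mono[OF IR[OF s]] by blast
      qed
      then show "y \<in> \<Union>(range (Q k))" using y by (auto simp: Q_def)
    qed
  qed (auto simp: Q_def)
  have "\<forall>k. (\<forall>U\<in>range (Q k). openin Y U) \<and> \<Union>(range (Q k)) = topspace Y"
    using Q_open Q_cover by blast
  then have "\<exists>V. (\<forall>k. finite (V k) \<and> V k \<subseteq> range (Q k)) \<and> \<Union>(\<Union>k. V k) = topspace Y"
    using Menger unfolding Menger_space_def by (elim allE[where x = "\<lambda>k. range (Q k)"]) (rule mp)
  then obtain V where V0: "\<forall>k. finite (V k) \<and> V k \<subseteq> range (Q k)" and V: "\<Union>(\<Union>k. V k) = topspace Y"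
    by (elim exE conjE) (rule that)
  have "\<exists>m. \<Union>(V k) \<subseteq> Q k m" for k
  proof -
    obtain J where J: "finite J" "V k = Q k ` J"
      using finite_subset_image[of "V k" "Q k" UNIV] V0 by blast
    have "\<Union>(V k) \<subseteq> Q k (Max (insert 0 J))"
    proof (rule Union_least)
      fix W assume "W \<in> V k"
      then obtain j where "j \<in> J" "W = Q k j" using J(2) by blast
      then show "W \<subseteq> Q k (Max (insert 0 J))" using J(1) by (auto intro!: Q_mono Max_ge)
    qed
    then show ?thesis ..
  qed
  then obtain f where f: "\<And>k. \<Union>(V k) \<subseteq> Q k (f k)" by metis
  define st where "st = rec_nat s0 (\<lambda>k s. nxt k s (f k))"
  have st: "st 0 = s0" "\<And>k. st (Suc k) = nxt k (st k) (f k)" by (simp_all add: st_def)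
  have Ist: "I (st k)" for k by (induction k) (auto simp: st init step)
  have "y \<in> (\<Union>k. G k (st k) (f k))" if y: "y \<in> topspace Y" for y
  proof (rule ccontr)
    assume neg: "y \<notin> (\<Union>k. G k (st k) (f k))"
    \<comment> \<open>A point missed by the whole play survives every answer, so the actual states
      all lie in \<open>R y k\<close>, from which \<open>Q k (f k)\<close> promises capture.\<close>
    have less: "f k < h y k (st k)" for k
    proof (rule ccontr)
      assume "\<not> f k < h y k (st k)"
      then have "G k (st k) (h y k (st k)) \<subseteq> G k (st k) (f k)" by (intro mono Ist) simp
      then show False using neg h_in[OF y Ist] by blast
    qed
    have stR: "st k \<in> R y k" for k
      by (induction k) (use less in \<open>auto simp: st R0 RSuc\<close>)
    obtain k where "y \<in> Q k (f k)" using y V f by blast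
    then have "y \<in> G k (st k) (f k)" using stR by (simp add: Q_def)
    then show False using neg by blast
  qed
  moreover have "G k (st k) (f k) \<subseteq> topspace Y" for k using opn[OF Ist] openin_subset by blast
  ultimately have "(\<Union>k. G k (st k) (f k)) = topspace Y" by blast
  with st show ?thesis by (intro exI[of _ st] exI[of _ f]) simp
qed

section \<open>Countable sets and closing off\<close>

lemma finite_to_nat_on_le:
  assumes "countable C"
  shows "finite {c \<in> C. to_nat_on C c \<le> k}"
  using finite_vimage_IntI[OF _ inj_on_to_nat_on[OF assms], of "{..k}"]
  by (simp add: vimage_def Int_def conj_commute)

text \<open>A finite subset of the union of the increasing stages already lies in one stage, so its
  witnesses \<open>c B\<close> enter at the next. Stages stay countable because a countable set has
  only countably many finite subsets.\<close>

lemma countable_closing_off: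
  assumes "\<And>B. finite B \<Longrightarrow> B \<subseteq> X \<Longrightarrow> countable (c B) \<and> c B \<subseteq> X"
  obtains A where "countable A" "A \<subseteq> X" "\<And>B. finite B \<Longrightarrow> B \<subseteq> A \<Longrightarrow> c B \<subseteq> A"
proof -
  define S where "S = rec_nat {} (\<lambda>k A. A \<union> (\<Union>B\<in>{B. finite B \<and> B \<subseteq> A}. c B))"
  have S0: "S 0 = {}" and SSuc: "S (Suc k) = S k \<union> (\<Union>B\<in>{B. finite B \<and> B \<subseteq> S k}. c B)" for k
    by (simp_all add: S_def)
  have S: "countable (S k) \<and> S k \<subseteq> X" for k
  proof (induction k)
    case 0
    show ?case by (simp add: S0)
  next
    case (Suc k)
    have "countable {B. finite B \<and> B \<subseteq> S k}"
      using countable_Collect_finite_subset[of "S k"] Suc by simp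
    moreover have "countable (c B) \<and> c B \<subseteq> X" if "finite B" "B \<subseteq> S k" for B
      using assms that Suc by (meson subset_trans)
    ultimately show ?case
      using Suc unfolding SSuc by (auto intro!: countable_Un countable_UN)
  qed
  have mono: "S k \<subseteq> S l" if "k \<le> l" for k l
    using that by (induction rule: dec_induct) (auto simp: SSuc)
  show thesis
  proof (rule that[of "\<Union>k. S k"])
    fix B assume B: "finite B" "B \<subseteq> (\<Union>k. S k)"
    have "\<exists>k. B \<subseteq> S k"
      using B
    proof (induction B rule: finite_induct)
      case (insert x B)
      then obtain k l where "B \<subseteq> S k" "x \<in> S l" by auto
      then have "insert x B \<subseteq> S (max k l)"
        using mono[of k "max k l"] mono[of l "max k l"] by auto
      then show ?case ..
    qed simp
    then obtain k where "B \<subseteq> S k" ..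
    with B(1) have "c B \<subseteq> S (Suc k)" unfolding SSuc by blast
    then show "c B \<subseteq> (\<Union>k. S k)" by blast
  qed (use S in auto)
qed

section \<open>Locally finite sets\<close>

text \<open>In a T1 space every neighbourhood of an accumulation point of \<open>B\<close> contains
  infinitely many points of \<open>B\<close>, so local finiteness empties the derived set.\<close>

lemma closed_discrete_if_locally_finite:
  assumes "t1_space T" "B \<subseteq> topspace T"
    and "\<And>y. y \<in> topspace T \<Longrightarrow> \<exists>N. openin T N \<and> y \<in> N \<and> finite (B \<inter> N)"
  shows "closedin T B" "subtopology T B = discrete_topology B"
proof -
  have "T derived_set_of B =
      {x \<in> topspace T. \<forall>U. x \<in> U \<and> openin T U \<longrightarrow> infinite (B \<inter> U)}"
    using assms(1) unfolding t1_space_derived_set_of_infinite_openin by blast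
  then have "T derived_set_of B = {}"
    using assms(3) by blast
  then show "closedin T B" "subtopology T B = discrete_topology B"
    using assms(2) by (simp_all add: closedin_contains_derived_set subtopology_eq_discrete_topology_eq)
qed

text \<open>Once the neighbourhoods of \<open>P k\<close> contain \<open>y\<close>, no later point
  enters their union, so this open set meets the chain only inside \<open>P k\<close>. Off
  \<open>C\<close> the complement of \<open>C\<close> is a neighbourhood that misses the
  chain.\<close>

lemma locally_finite_Union_chain:
  assumes opn: "\<And>x. x \<in> topspace T \<Longrightarrow> openin T (U x)"
    and P: "\<And>k. finite (P k)" "\<And>k. P k \<subseteq> topspace T" "\<And>k. P k \<subseteq> P (Suc k)"
    and new: "\<And>k. (P (Suc k) - P k) \<inter> (\<Union>x\<in>P k. U x) = {}"
    and C: "closedin T C" "(\<Union>k. P k) \<subseteq> C" "C \<subseteq> (\<Union>k. \<Union>x\<in>P k. U x)"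
    and y: "y \<in> topspace T"
  shows "\<exists>N. openin T N \<and> y \<in> N \<and> finite ((\<Union>k. P k) \<inter> N)"
proof (cases "y \<in> C")
  case False
  moreover have "openin T (topspace T - C)" using C(1) by blast
  moreover have "(\<Union>k. P k) \<inter> (topspace T - C) = {}" using C(2) by blast
  ultimately show ?thesis using y by (intro exI[of _ "topspace T - C"]) simp
next
  case True
  then obtain k where k: "y \<in> (\<Union>x\<in>P k. U x)" using C by blast
  have "P l \<inter> (\<Union>x\<in>P k. U x) \<subseteq> P k" for l
  proof (cases "k \<le> l")
    case True
    then show ?thesis
    proof (induction rule: dec_induct)
      case (step n)
      have "P k \<subseteq> P n" using lift_Suc_mono_le[of P k n] P(3) step by blast
      then show ?case using new[of n] step.IH by blast
    qed simp
  next
    case False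
    then have "P l \<subseteq> P k" using lift_Suc_mono_le[of P l k] P(3) by simp
    then show ?thesis by blast
  qed
  then have "finite ((\<Union>k. P k) \<inter> (\<Union>x\<in>P k. U x))"
    by (intro finite_subset[OF _ P(1)[of k]]) blast
  moreover have "openin T (\<Union>x\<in>P k. U x)" using opn P(2) by blast
  ultimately show ?thesis using k by blast
qed

text \<open>Greedy selection along an enumeration of \<open>C\<close>: each element is added only if
  the earlier choices do not cover it yet. The chain of stages stays inside the closed set
  \<open>C\<close> and covers it, as \<open>locally_finite_Union_chain\<close> requires.\<close>

lemma countable_closed_locally_finite:
  assumes opn: "\<And>x. x \<in> topspace T \<Longrightarrow> openin T (U x) \<and> x \<in> U x"
    and C: "closedin T C" "countable C"
  shows "\<exists>B. B \<subseteq> C \<and> C \<subseteq> (\<Union>x\<in>B. U x) \<and>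
    (\<forall>y\<in>topspace T. \<exists>N. openin T N \<and> y \<in> N \<and> finite (B \<inter> N))"
proof -
  have CT: "C \<subseteq> topspace T" using C(1) by (rule closedin_subset)
  define P where "P = rec_nat {} (\<lambda>k P. P \<union> ({c\<in>C. to_nat_on C c = k} - (\<Union>x\<in>P. U x)))"
  have P0: "P 0 = {}" and PSuc: "P (Suc k) = P k \<union> ({c\<in>C. to_nat_on C c = k} - (\<Union>x\<in>P k. U x))" for k
    by (simp_all add: P_def)
  have "finite {c\<in>C. to_nat_on C c = k}" for k
    by (rule finite_subset[OF _ finite_to_nat_on_le[OF C(2), of k]]) blast
  then have fin: "finite (P k)" for k by (induction k) (auto simp: P0 PSuc)
  have PC: "P k \<subseteq> C" for k by (induction k) (auto simp: P0 PSuc)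
  have cov: "C \<subseteq> (\<Union>k. \<Union>x\<in>P k. U x)"
  proof
    fix c assume c: "c \<in> C"
    have "c \<in> (\<Union>x\<in>P (Suc (to_nat_on C c)). U x)"
      using c CT opn unfolding PSuc by blast
    then show "c \<in> (\<Union>k. \<Union>x\<in>P k. U x)" by blast
  qed
  show ?thesis
  proof (rule exI[of _ "\<Union>k. P k"], intro conjI ballI)
    show "\<exists>N. openin T N \<and> y \<in> N \<and> finite ((\<Union>k. P k) \<inter> N)" if "y \<in> topspace T" for y
    proof (rule locally_finite_Union_chain[where P = P and U = U and C = C])
      show "(P (Suc k) - P k) \<inter> (\<Union>x\<in>P k. U x) = {}" for k unfolding PSuc by blast
      show "P k \<subseteq> topspace T" for k using PC CT by blast
      show "P k \<subseteq> P (Suc k)" for k unfolding PSuc by blast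
      show "(\<Union>k. P k) \<subseteq> C" using PC by blast
    qed (use opn fin C cov that in simp_all)
    show "(\<Union>k. P k) \<subseteq> C" using PC by blast
    show "C \<subseteq> (\<Union>x\<in>(\<Union>k. P k). U x)" using cov by blast
  qed
qed

section \<open>Types of points and HFC\<close>

locale hfc_assignment =
  fixes r :: "'l rel" and X :: "('l \<Rightarrow> bool) set" and F :: "('l \<Rightarrow> bool) \<Rightarrow> 'l set"
  assumes wo: "Well_order r" and hfc: "HFC r X"
    and F: "\<And>x. x \<in> X \<Longrightarrow> finite (F x) \<and> F x \<subseteq> Field r"
begin

definition nbhd :: "('l \<Rightarrow> bool) \<Rightarrow> ('l \<Rightarrow> bool) set" where
  "nbhd x = {y \<in> X. \<forall>\<alpha>\<in>F x. y \<alpha> = x \<alpha>}"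

definition nbhds :: "('l \<Rightarrow> bool) set \<Rightarrow> ('l \<Rightarrow> bool) set" where
  "nbhds D = (\<Union>x\<in>D. nbhd x)"

text \<open>For \<alpha> in \<open>G\<close> this is the position of \<alpha> in the increasing
  enumeration of \<open>G\<close>, in the form used by \<open>star\<close>.\<close>

definition rank :: "'l set \<Rightarrow> 'l \<Rightarrow> nat" where
  "rank G \<alpha> = card (G \<inter> underS r \<alpha>)"

text \<open>The type of \<open>x\<close> over \<open>E\<close>: its restriction to \<open>E\<close>, and the \<open>n\<close> and \<open>b\<close> for which the rest of
  \<open>x\<restriction>F x\<close> is \<open>(F x - E) * b\<close>; the 0-1 sequence \<open>b\<close> is coded by \<open>{i. b i = 1}\<close>.\<close>

definition ptype :: "'l set \<Rightarrow> ('l \<Rightarrow> bool) \<Rightarrow> 'l set \<times> nat \<times> nat set" where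
  "ptype E x = ({\<alpha>\<in>E. x \<alpha>}, card (F x - E), rank (F x - E) ` {\<alpha>\<in>F x - E. x \<alpha>})"

definition of_type :: "'l set \<Rightarrow> 'l set \<times> nat \<times> nat set \<Rightarrow> ('l \<Rightarrow> bool) set" where
  "of_type E \<tau> = {x \<in> X. E \<subseteq> F x \<and> ptype E x = \<tau>}"

lemma nbhd_self: "x \<in> X \<Longrightarrow> x \<in> nbhd x"
  by (simp add: nbhd_def)

lemma rank_less:
  assumes "finite G" "\<alpha> \<in> G" "(\<alpha>, \<beta>) \<in> r" "\<alpha> \<noteq> \<beta>"
  shows "rank G \<alpha> < rank G \<beta>"
  unfolding rank_def
proof (rule psubset_card_mono)
  have "underS r \<alpha> \<subseteq> underS r \<beta>"
    using wo assms(3) by (intro underS_incr) (auto simp: order_on_defs)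
  moreover have "\<alpha> \<in> underS r \<beta>" "\<alpha> \<notin> underS r \<alpha>" using assms(3,4) by (auto simp: underS_def)
  ultimately show "G \<inter> underS r \<alpha> \<subset> G \<inter> underS r \<beta>" using assms(2) by blast
qed (use assms(1) in simp)

lemma inj_on_rank:
  assumes "finite G" "G \<subseteq> Field r"
  shows "inj_on (rank G) G"
proof (rule inj_onI, rule ccontr)
  fix \<alpha> \<beta> assume *: "\<alpha> \<in> G" "\<beta> \<in> G" "rank G \<alpha> = rank G \<beta>" "\<alpha> \<noteq> \<beta>"
  have "(\<alpha>, \<beta>) \<in> r \<or> (\<beta>, \<alpha>) \<in> r"
    using wo * assms(2) by (auto simp: order_on_defs total_on_def)
  then show False using rank_less[OF assms(1)] * by (metis less_irrefl)
qed

lemma rank_less_card: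
  assumes "finite G" "\<alpha> \<in> G"
  shows "rank G \<alpha> < card G"
  unfolding rank_def by (rule psubset_card_mono) (use assms in \<open>auto simp: underS_def\<close>)

text \<open>On \<open>E\<close> both points have the restriction coded by \<open>S\<close>. On the
  remainder of \<open>F q\<close> both follow the code \<open>P\<close>: \<open>q\<close> by its
  type, \<open>z\<close> by the basic open set.\<close>

lemma mem_nbhd_if_star:
  assumes q: "q \<in> of_type E (S, n, P)" and z: "z \<in> of_type E (S, n, P)"
    and star: "z \<in> basic_open r (star r (F q - E) (\<lambda>i\<in>{..<n}. i \<in> P))"
  shows "z \<in> nbhd q"
proof -
  let ?G = "F q - E"
  have qX: "q \<in> X" and tq: "{\<alpha>\<in>E. q \<alpha>} = S" "card ?G = n" "rank ?G ` {\<alpha>\<in>?G. q \<alpha>} = P"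
    using q by (auto simp: of_type_def ptype_def)
  have zX: "z \<in> X" and tz: "{\<alpha>\<in>E. z \<alpha>} = S"
    using z by (auto simp: of_type_def ptype_def)
  have fin: "finite ?G" "?G \<subseteq> Field r" using F[OF qX] by auto
  have "z \<alpha> = q \<alpha>" if "\<alpha> \<in> F q" for \<alpha>
  proof (cases "\<alpha> \<in> E")
    case True
    then show ?thesis using tq(1) tz by blast
  next
    case False
    then have \<alpha>: "\<alpha> \<in> ?G" using that by blast
    then have "\<alpha> \<in> dom (star r ?G (\<lambda>i\<in>{..<n}. i \<in> P))" by (simp add: star_def dom_def)
    then have "star r ?G (\<lambda>i\<in>{..<n}. i \<in> P) \<alpha> = Some (z \<alpha>)"
      using star unfolding basic_open_def by blast
    then have "z \<alpha> = (\<lambda>i\<in>{..<n}. i \<in> P) (rank ?G \<alpha>)"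
      using \<alpha> by (simp add: star_def rank_def)
    also have "\<dots> \<longleftrightarrow> rank ?G \<alpha> \<in> P"
      using rank_less_card[OF fin(1) \<alpha>] tq(2) by simp
    \<comment> \<open>Injectivity of \<open>rank\<close> on the remainder means that a position lies
      in \<open>P\<close> only on account of \<alpha> itself.\<close>
    also have "\<dots> \<longleftrightarrow> q \<alpha>"
      using inj_on_image_mem_iff[OF inj_on_rank[OF fin] \<alpha>, of "{\<alpha>\<in>?G. q \<alpha>}"] \<alpha> unfolding tq(3)
      by auto
    finally show ?thesis .
  qed
  then show ?thesis using zX by (simp add: nbhd_def)
qed

text \<open>With \<open>n = 0\<close> the support of \<open>q\<close> is exactly \<open>E\<close>,
  where all points of the type agree. The case stands apart because there is no infinite family of
  empty sets to which HFC could be applied.\<close>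

lemma mem_nbhd_if_same_type:
  assumes q: "q \<in> of_type E (S, 0, P)" and z: "z \<in> of_type E (S, 0, P)"
  shows "z \<in> nbhd q"
proof -
  have "finite (F q - E)" "card (F q - E) = 0"
    using q F by (auto simp: of_type_def ptype_def)
  then have "F q - E = {}" by simp
  moreover have "z \<in> X" "{\<alpha>\<in>E. q \<alpha>} = S" "{\<alpha>\<in>E. z \<alpha>} = S" using q z by (auto simp: of_type_def ptype_def)
  ultimately show ?thesis unfolding nbhd_def by blast
qed

text \<open>HFC applies to the remainders \<open>F (q i) - E\<close>, which are pairwise disjoint
  sets of size \<open>n\<close>; by \<open>mem_nbhd_if_star\<close> their basic open sets capture
  points of the type only inside the neighbourhoods of the \<open>q i\<close>.\<close>

lemma countable_of_type_minus_nbhds: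
  fixes q :: "nat \<Rightarrow> 'l \<Rightarrow> bool"
  assumes q: "\<And>i. q i \<in> of_type E (S, n, P)" and "n \<noteq> 0"
    and disj: "\<And>i j. i < j \<Longrightarrow> disjnt (F (q j) - E) (F (q i))"
  shows "countable (of_type E (S, n, P) - nbhds (range q))"
proof -
  define G where "G i = F (q i) - E" for i
  define b where "b = (\<lambda>i\<in>{..<n}. i \<in> P)"
  have disjG: "disjnt (G i) (G j)" if "i \<noteq> j" for i j
    using that disj[of i j] disj[of j i] by (auto simp: G_def disjnt_def neq_iff)
  have G: "finite (G i)" "G i \<subseteq> Field r" "card (G i) = n" for i
    using q[of i] F[of "q i"] by (auto simp: G_def of_type_def ptype_def)
  \<comment> \<open>Disjoint nonempty sets are distinct, which makes the family of remainders
    infinite.\<close>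
  have ne: "G i \<noteq> {}" for i using G(3)[of i] \<open>n \<noteq> 0\<close> by auto
  have "inj G"
  proof (rule injI, rule ccontr)
    fix i j assume "G i = G j" "i \<noteq> j"
    then show False using disjG[of i j] ne[of j] by simp
  qed
  then have "infinite (range G)" by (rule range_inj_infinite)
  moreover have "pairwise disjnt (range G)"
  proof (rule pairwiseI, elim rangeE)
    fix H H' i j assume "H \<noteq> H'" "H = G i" "H' = G j"
    then show "disjnt H H'" using disjG[of i j] by (cases "i = j") simp_all
  qed
  moreover have "range G \<subseteq> nsets (Field r) n" using G by (auto simp: nsets_def)
  moreover have "b \<in> {..<n} \<rightarrow>\<^sub>E UNIV" by (simp add: b_def)
  ultimately have "countable (X - (\<Union>H\<in>range G. basic_open r (star r H b)))"
    using hfc unfolding HFC_def by blast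
  moreover have "of_type E (S, n, P) - nbhds (range q) \<subseteq> X - (\<Union>H\<in>range G. basic_open r (star r H b))"
    using mem_nbhd_if_star[OF q] unfolding G_def b_def nbhds_def of_type_def by blast
  ultimately show ?thesis by (rule countable_subset[rotated])
qed

text \<open>The supports of finitely many earlier terms form an admissible \<open>K\<close>, so the
  next term can always be chosen with its remainder off them.\<close>

lemma ex_disjoint_sequence:
  assumes "\<And>K. finite K \<Longrightarrow> K \<subseteq> L \<Longrightarrow> \<exists>x\<in>V. disjnt (F x - E) K"
    and "\<And>x. x \<in> V \<Longrightarrow> finite (F x) \<and> F x \<subseteq> L"
  shows "\<exists>q::nat \<Rightarrow> _. \<forall>j. q j \<in> V \<and> (\<forall>i<j. disjnt (F (q j) - E) (F (q i)))"
proof (rule dependent_wellorder_choice)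
  fix f :: "nat \<Rightarrow> 'l \<Rightarrow> bool" and j
  assume "\<And>i. i < j \<Longrightarrow> f i \<in> V \<and> (\<forall>k<i. disjnt (F (f i) - E) (F (f k)))"
  then have "finite (\<Union>i<j. F (f i))" "(\<Union>i<j. F (f i)) \<subseteq> L" using assms(2) by auto
  then obtain x where "x \<in> V" "disjnt (F x - E) (\<Union>i<j. F (f i))" using assms(1) by blast
  then show "\<exists>x. x \<in> V \<and> (\<forall>i<j. disjnt (F x - E) (F (f i)))" by (intro exI[of _ x]) (auto simp: disjnt_def)
qed auto

section \<open>Countable reflecting sets\<close>

definition spread :: "('l \<Rightarrow> bool) set \<Rightarrow> 'l set \<Rightarrow> (nat \<Rightarrow> 'l \<Rightarrow> bool) \<Rightarrow> bool" where
  "spread V E q \<longleftrightarrow> (\<forall>j. q j \<in> V \<and> (\<forall>i<j. disjnt (F (q j) - E) (F (q i))))"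

text \<open>These two predicates express the instances of elementarity that replace \<open>A = X \<inter> M\<close> for a countable
  elementary submodel \<open>M\<close>.\<close>

definition catches ::
  "('l \<Rightarrow> bool) set \<Rightarrow> ('l \<Rightarrow> bool) set \<Rightarrow> 'l set \<Rightarrow> 'l set \<Rightarrow> bool" where
  "catches A V E K \<longleftrightarrow>
     ((\<exists>x\<in>V. disjnt (F x - E) K) \<longrightarrow> (\<exists>x\<in>A. x \<in> V \<and> disjnt (F x - E) K))"

definition exhausts ::
  "('l \<Rightarrow> bool) set \<Rightarrow> ('l \<Rightarrow> bool) set \<Rightarrow> 'l set \<Rightarrow> ('l \<Rightarrow> bool) set \<Rightarrow> bool" where
  "exhausts A V E W \<longleftrightarrow>
     ((\<exists>q. spread V E q) \<longrightarrow> (\<exists>q. spread V E q \<and> range q \<subseteq> A \<and> W - nbhds (range q) \<subseteq> A))"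

text \<open>The component \<open>fst (snd \<tau>)\<close> is the size \<open>n\<close> of the
  remainder; exhausting is demanded only where HFC applies.\<close>

definition reflects ::
  "('l \<Rightarrow> bool) set \<Rightarrow> ('l \<Rightarrow> bool) set \<Rightarrow> 'l set \<Rightarrow> 'l set \<Rightarrow> 'l set \<times> nat \<times> nat set \<Rightarrow> bool" where
  "reflects A D E K \<tau> \<longleftrightarrow> catches A (of_type E \<tau> - nbhds D) E K \<and>
     (fst (snd \<tau>) \<noteq> 0 \<longrightarrow> exhausts A (of_type E \<tau> - nbhds D) E (of_type E \<tau>))"

lemma catches_mono: "catches A V E K \<Longrightarrow> A \<subseteq> A' \<Longrightarrow> catches A' V E K"
  unfolding catches_def by blast

lemma exhausts_mono: "exhausts A V E W \<Longrightarrow> A \<subseteq> A' \<Longrightarrow> exhausts A' V E W"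
  unfolding exhausts_def by (meson subset_trans)

lemma reflects_mono: "reflects A D E K \<tau> \<Longrightarrow> A \<subseteq> A' \<Longrightarrow> reflects A' D E K \<tau>"
  unfolding reflects_def by (meson catches_mono exhausts_mono)

text \<open>A single point suffices for \<open>catches\<close>. For \<open>exhausts\<close> one
  takes the terms of one spread sequence together with the points of the type that their
  neighbourhoods miss, countably many by HFC.\<close>

lemma ex_reflects: "\<exists>C. countable C \<and> C \<subseteq> X \<and> reflects C D E K \<tau>"
proof -
  let ?V = "of_type E \<tau> - nbhds D"
  have VX: "?V \<subseteq> X" by (auto simp: of_type_def)
  have "\<exists>C. countable C \<and> C \<subseteq> X \<and> catches C ?V E K"
  proof (cases "\<exists>x\<in>?V. disjnt (F x - E) K")
    case True
    then obtain x where "x \<in> ?V" "disjnt (F x - E) K" ..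
    then show ?thesis using VX by (intro exI[of _ "{x}"]) (auto simp: catches_def)
  qed (auto simp: catches_def)
  then obtain C1 where C1: "countable C1" "C1 \<subseteq> X" "catches C1 ?V E K" by blast
  have "\<exists>C. countable C \<and> C \<subseteq> X \<and> (fst (snd \<tau>) \<noteq> 0 \<longrightarrow> exhausts C ?V E (of_type E \<tau>))"
  proof (cases "fst (snd \<tau>) \<noteq> 0 \<and> (\<exists>q. spread ?V E q)")
    case True
    then obtain q where q: "spread ?V E q" by blast
    obtain S n P where \<tau>: "\<tau> = (S, n, P)" by (cases \<tau>)
    have "countable (of_type E \<tau> - nbhds (range q))"
      unfolding \<tau> by (rule countable_of_type_minus_nbhds) (use q True in \<open>auto simp: spread_def \<tau>\<close>)
    moreover have "range q \<subseteq> X" using q VX by (auto simp: spread_def)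
    moreover have "exhausts (range q \<union> (of_type E \<tau> - nbhds (range q))) ?V E (of_type E \<tau>)"
      unfolding exhausts_def using q by blast
    ultimately show ?thesis
      by (intro exI[of _ "range q \<union> (of_type E \<tau> - nbhds (range q))"]) (auto simp: of_type_def)
  next
    case False
    then show ?thesis by (intro exI[of _ "{}"]) (auto simp: exhausts_def)
  qed
  then obtain C2 where C2: "countable C2" "C2 \<subseteq> X" "fst (snd \<tau>) \<noteq> 0 \<longrightarrow> exhausts C2 ?V E (of_type E \<tau>)"
    by blast
  have "reflects (C1 \<union> C2) D E K \<tau>"
    unfolding reflects_def using catches_mono[OF C1(3)] exhausts_mono C2(3) by (meson Un_upper1 Un_upper2)
  then show ?thesis using C1(1,2) C2(1,2) by (intro exI[of _ "C1 \<union> C2"]) simp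
qed

text \<open>The bounds on the parameters leave only countably many of them for a countable
  \<open>A \<subseteq> X\<close>, and each is already available over a finite subset of
  \<open>A\<close>.\<close>

definition reflecting :: "('l \<Rightarrow> bool) set \<Rightarrow> bool" where
  "reflecting A \<longleftrightarrow> (\<forall>D E K \<tau>. finite D \<longrightarrow> D \<subseteq> A \<longrightarrow> finite E \<longrightarrow> E \<subseteq> \<Union>(F ` A) \<longrightarrow>
     finite K \<longrightarrow> K \<subseteq> \<Union>(F ` A) \<longrightarrow> fst \<tau> \<subseteq> E \<longrightarrow> finite (snd (snd \<tau>)) \<longrightarrow> reflects A D E K \<tau>)"

lemma ex_reflecting_set: "\<exists>A. countable A \<and> A \<subseteq> X \<and> reflecting A"
proof -
  have "\<forall>p. \<exists>C. countable C \<and> C \<subseteq> X \<and> (case p of (D, E, K, \<tau>) \<Rightarrow> reflects C D E K \<tau>)"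
    using ex_reflects by auto
  then obtain w where w: "\<And>D E K \<tau>. countable (w (D, E, K, \<tau>)) \<and>
      w (D, E, K, \<tau>) \<subseteq> X \<and> reflects (w (D, E, K, \<tau>)) D E K \<tau>"
    by (metis (mono_tags, lifting) case_prod_conv)
  then have w': "countable (w p) \<and> w p \<subseteq> X" for p by (cases p) blast
  define fin where "fin L = {K. finite K \<and> K \<subseteq> L}" for L :: "'l set"
  define par where "par B = {D. finite D \<and> D \<subseteq> B} \<times> fin (\<Union>(F ` B)) \<times> fin (\<Union>(F ` B)) \<times>
      fin (\<Union>(F ` B)) \<times> (UNIV :: nat set) \<times> {P :: nat set. finite P}" for B
  define c where "c B = (\<Union>p\<in>par B. w p)" for B
  have small: "countable (c B) \<and> c B \<subseteq> X" if "finite B" "B \<subseteq> X" for B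
  proof -
    have "finite (\<Union>(F ` B))" using that F by auto
    then have "countable (fin (\<Union>(F ` B)))"
      unfolding fin_def by (intro countable_Collect_finite_subset countable_finite)
    moreover have "countable {D. finite D \<and> D \<subseteq> B}"
      using that by (intro countable_Collect_finite_subset countable_finite)
    moreover have "countable {P :: nat set. finite P}" by (rule countable_Collect_finite)
    ultimately have "countable (par B)" unfolding par_def by (intro countable_SIGMA) simp_all
    then show ?thesis unfolding c_def using w' by (simp add: UN_least)
  qed
  show ?thesis
  proof (rule countable_closing_off[OF small], assumption, assumption)
    fix A assume A: "countable A" "A \<subseteq> X" "\<And>B. finite B \<Longrightarrow> B \<subseteq> A \<Longrightarrow> c B \<subseteq> A"
    have "reflects A D E K \<tau>" if D: "finite D" "D \<subseteq> A" and E: "finite E" "E \<subseteq> \<Union>(F ` A)"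
      and K: "finite K" "K \<subseteq> \<Union>(F ` A)" and \<tau>: "fst \<tau> \<subseteq> E" "finite (snd (snd \<tau>))" for D E K \<tau>
    proof -
      \<comment> \<open>Finite sets of coordinates involve only finitely many supports, so
        \<open>D\<close>, \<open>E\<close>, \<open>K\<close> and \<tau> are parameters over the
        finite set \<open>B \<union> D\<close>, whose witnesses lie in \<open>A\<close>.\<close>
      have "\<exists>B\<subseteq>A. finite B \<and> H \<subseteq> \<Union>(F ` B)" if "finite H" "H \<subseteq> \<Union>(F ` A)" for H
        using finite_subset_Union[OF that] by (metis finite_subset_image)
      from this[of "E \<union> K"] E K obtain B where B: "B \<subseteq> A" "finite B" "E \<union> K \<subseteq> \<Union>(F ` B)" by auto
      obtain S n P where \<tau>': "\<tau> = (S, n, P)" by (cases \<tau>)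
      have "E \<subseteq> \<Union>(F ` (B \<union> D))" "K \<subseteq> \<Union>(F ` (B \<union> D))" using B(3) by auto
      moreover have "S \<subseteq> E" "finite S" using \<tau> E(1) finite_subset by (auto simp: \<tau>')
      ultimately have "(D, E, K, \<tau>) \<in> par (B \<union> D)"
        using D E K \<tau> by (auto simp: par_def fin_def \<tau>')
      then have "w (D, E, K, \<tau>) \<subseteq> c (B \<union> D)" unfolding c_def by blast
      also have "\<dots> \<subseteq> A" using A(3) B D by simp
      finally show "reflects A D E K \<tau>" using w reflects_mono by blast
    qed
    then show ?thesis using A(1,2) unfolding reflecting_def by blast
  qed
qed

end

section \<open>Covering by neighbourhoods of points of a reflecting set\<close>

locale hfc_reflecting = hfc_assignment r X F for r :: "'l rel" and X F +
  fixes A :: "('l \<Rightarrow> bool) set"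
  assumes ctA: "countable A" and AX: "A \<subseteq> X"
    and reflecting: "reflecting A"
begin

lemmas reflect = reflecting[unfolded reflecting_def, rule_format]

text \<open>The counterpart of \<open>F z \<inter> M\<close> for an elementary submodel
  \<open>M\<close>: the part of the support of \<open>z\<close> that \<open>A\<close> can
  see.\<close>

definition trace :: "('l \<Rightarrow> bool) \<Rightarrow> 'l set" where
  "trace z = F z \<inter> \<Union>(F ` A)"

definition trace_type :: "('l \<Rightarrow> bool) \<Rightarrow> 'l set \<times> 'l set \<times> nat \<times> nat set" where
  "trace_type z = (trace z, ptype (trace z) z)"

lemma trace_type_facts:
  assumes "z \<in> X"
  shows "finite (trace z)" "trace z \<subseteq> \<Union>(F ` A)" "fst (ptype (trace z) z) \<subseteq> trace z"
    "finite (snd (snd (ptype (trace z) z)))" "z \<in> of_type (trace z) (ptype (trace z) z)"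
  using F[OF assms] assms by (auto simp: trace_def ptype_def of_type_def)

lemma countable_trace_types: "countable (trace_type ` X)"
proof -
  let ?fin = "{E. finite E \<and> E \<subseteq> \<Union>(F ` A)}"
  have "countable (\<Union>(F ` A))"
    by (rule countable_UN[OF ctA], rule countable_finite) (use AX F in blast)
  then have "countable ?fin" by (rule countable_Collect_finite_subset)
  moreover have "countable {P :: nat set. finite P}" by (rule countable_Collect_finite)
  ultimately have "countable (?fin \<times> ?fin \<times> (UNIV :: nat set) \<times> {P :: nat set. finite P})"
    by (intro countable_SIGMA) simp_all
  moreover have "trace_type ` X \<subseteq> ?fin \<times> ?fin \<times> (UNIV :: nat set) \<times> {P :: nat set. finite P}"
  proof
    fix t assume "t \<in> trace_type ` X"
    then obtain z where z: "z \<in> X" "t = (trace z, ptype (trace z) z)" by (auto simp: trace_type_def)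
    obtain S n P where p: "ptype (trace z) z = (S, n, P)" by (cases "ptype (trace z) z")
    show "t \<in> ?fin \<times> ?fin \<times> (UNIV :: nat set) \<times> {P :: nat set. finite P}"
      using trace_type_facts[OF z(1)] finite_subset unfolding z(2) p by auto
  qed
  ultimately show ?thesis by (rule countable_subset[rotated])
qed

text \<open>For every finite \<open>K\<close> in the union of the supports, \<open>z\<close> itself realises its type over \<open>trace z\<close>
  with remainder disjoint from \<open>K\<close>, so some element of \<open>A\<close> does as well.\<close>

lemma ex_catch:
  assumes D: "finite D" "D \<subseteq> A" and z: "z \<in> X - nbhds D" and K: "finite K" "K \<subseteq> \<Union>(F ` A)"
  shows "\<exists>x\<in>A. x \<in> of_type (trace z) (ptype (trace z) z) - nbhds D \<and> disjnt (F x - trace z) K"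
proof -
  have zX: "z \<in> X" using z by blast
  note t = trace_type_facts[OF zX]
  have "catches A (of_type (trace z) (ptype (trace z) z) - nbhds D) (trace z) K"
    using reflect[OF D t(1,2) K t(3,4)] unfolding reflects_def by blast
  moreover have "disjnt (F z - trace z) K" using K by (auto simp: disjnt_def trace_def)
  ultimately show ?thesis using t(5) z unfolding catches_def by blast
qed

text \<open>The type of an uncovered \<open>z\<close> is realised in \<open>A\<close> outside
  \<open>nbhds D\<close> with remainders off any given finite set. If its remainder is nonempty,
  this yields a spread sequence, and \<open>exhausts\<close> puts every point of the type missed by
  a suitable such sequence into \<open>A\<close>; as \<open>z\<close> is not in \<open>A\<close>,
  that sequence covers it.\<close>

lemma covered_by_reflecting_set:
  assumes D: "finite D" "D \<subseteq> A"
  shows "X \<subseteq> nbhds D \<union> nbhds (A - nbhds D)"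
proof (rule subsetI, rule ccontr)
  fix z assume zX: "z \<in> X" and neg: "z \<notin> nbhds D \<union> nbhds (A - nbhds D)"
  have zA: "z \<notin> A" using neg nbhd_self[OF zX] by (auto simp: nbhds_def)
  note t = trace_type_facts[OF zX]
  obtain S n P where \<tau>: "ptype (trace z) z = (S, n, P)" by (cases "ptype (trace z) z")
  let ?T = "of_type (trace z) (S, n, P)"
  have catch: "\<exists>x\<in>A \<inter> (?T - nbhds D). disjnt (F x - trace z) K" if "finite K" "K \<subseteq> \<Union>(F ` A)" for K
    using ex_catch[OF D _ that, of z] zX neg unfolding \<tau> by blast
  have zT: "z \<in> ?T" using t(5) unfolding \<tau> .
  show False
  proof (cases "n = 0")
    case True
    obtain x where "x \<in> A" "x \<in> ?T" "x \<notin> nbhds D" using catch[of "{}"] by blast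
    moreover have "z \<in> nbhd x" using mem_nbhd_if_same_type calculation(2) zT unfolding True by blast
    ultimately show False using neg by (auto simp: nbhds_def)
  next
    case False
    have "\<exists>q. spread (A \<inter> (?T - nbhds D)) (trace z) q"
      unfolding spread_def by (rule ex_disjoint_sequence[OF catch]) (use AX F in auto)
    then have "\<exists>q. spread (?T - nbhds D) (trace z) q" unfolding spread_def by blast
    moreover have "exhausts A (?T - nbhds D) (trace z) ?T"
      using reflect[OF D t(1,2) finite.emptyI empty_subsetI t(3,4)] False unfolding reflects_def \<tau> by simp
    \<comment> \<open>The sequence built above only triggers \<open>exhausts\<close>; the one
      obtained here also has all its uncovered points of the type in \<open>A\<close>.\<close>
    ultimately obtain q where q: "spread (?T - nbhds D) (trace z) q" "range q \<subseteq> A" "?T - nbhds (range q) \<subseteq> A"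
      unfolding exhausts_def by blast
    then obtain i where "z \<in> nbhd (q i)" using zT zA by (auto simp: nbhds_def)
    moreover have "q i \<in> A - nbhds D" using q(1,2) by (auto simp: spread_def)
    ultimately show False using neg by (auto simp: nbhds_def)
  qed
qed

section \<open>Serving types during the game\<close>

text \<open>Here \<open>t\<close> pairs a trace with a type over it. Keeping the remainder off all
  supports used so far makes successive choices spread.\<close>

definition candidates :: "'l set \<times> 'l set \<times> nat \<times> nat set \<Rightarrow> ('l \<Rightarrow> bool) set \<Rightarrow> ('l \<Rightarrow> bool) set" where
  "candidates t D = {x \<in> A. x \<in> of_type (fst t) (snd t) - nbhds D \<and> disjnt (F x - fst t) (\<Union>(F ` D))}"

text \<open>At stage \<open>k\<close> the first \<open>k\<close> types are served. A point that is never covered keeps its own type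
  servable, so this type receives infinitely many points with pairwise disjoint remainders, and HFC applies.\<close>

definition serve :: "nat \<Rightarrow> ('l \<Rightarrow> bool) set \<Rightarrow> ('l \<Rightarrow> bool) set" where
  "serve k D = (\<lambda>t. SOME x. x \<in> candidates t D) `
     {t \<in> {t \<in> trace_type ` X. to_nat_on (trace_type ` X) t \<le> k}. candidates t D \<noteq> {}}"

text \<open>The answer \<open>i\<close> decides how far the enumeration of \<open>A\<close> is
  followed, whereas the served points enter whatever the answer is. All new points come from outside
  \<open>nbhds D\<close>.\<close>

definition extend :: "nat \<Rightarrow> ('l \<Rightarrow> bool) set \<Rightarrow> nat \<Rightarrow> ('l \<Rightarrow> bool) set" where
  "extend k D i = D \<union> ({a \<in> A. to_nat_on A a \<le> i} - nbhds D) \<union> serve k D"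

lemma finite_serve: "finite (serve k D)"
  unfolding serve_def
  by (intro finite_imageI finite_subset[OF _ finite_to_nat_on_le[OF countable_trace_types, of k]]) blast

lemma some_candidate: "candidates t D \<noteq> {} \<Longrightarrow> (SOME x. x \<in> candidates t D) \<in> candidates t D"
  by (simp add: some_in_eq)

lemma serve_subset: "serve k D \<subseteq> A - nbhds D"
proof
  fix x assume "x \<in> serve k D"
  then obtain t where "candidates t D \<noteq> {}" "x = (SOME x. x \<in> candidates t D)"
    unfolding serve_def by blast
  then have "x \<in> candidates t D" using some_candidate by simp
  then show "x \<in> A - nbhds D" unfolding candidates_def by blast
qed

lemma extend_facts:
  assumes "finite D \<and> D \<subseteq> A"
  shows "finite (extend k D i) \<and> extend k D i \<subseteq> A"
proof -
  have "serve k D \<subseteq> A" using serve_subset by blast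
  then show ?thesis
    unfolding extend_def using assms finite_serve finite_to_nat_on_le[OF ctA] by auto
qed

text \<open>The game is played on the closure of \<open>A\<close> with the finite sets
  \<open>D\<close> as states; \<open>covered_by_reflecting_set\<close> supplies the covers. Points
  missed by the final chain have countably many trace types, and HFC leaves countably many uncovered
  points in each.\<close>

lemma ex_covering_chain:
  assumes top: "topspace Z = X" and opn: "\<And>x. x \<in> X \<Longrightarrow> openin Z (nbhd x)"
    and Menger: "Menger_space (subtopology Z (Z closure_of A))"
  shows "\<exists>P :: nat \<Rightarrow> ('l \<Rightarrow> bool) set.
    (\<forall>k. finite (P k) \<and> P k \<subseteq> A \<and> P k \<subseteq> P (Suc k) \<and> (P (Suc k) - P k) \<inter> nbhds (P k) = {}) \<and>
    Z closure_of A \<subseteq> (\<Union>k. nbhds (P k)) \<and> countable (X - (\<Union>k. nbhds (P k)))"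
proof -
  let ?Y = "Z closure_of A"
  have YX: "?Y \<subseteq> X" using closure_of_subset_topspace[of Z A] top by simp
  have "\<exists>P f. P 0 = {} \<and> (\<forall>k. P (Suc k) = extend k (P k) (f k)) \<and>
      (\<Union>k. ?Y \<inter> nbhds (extend k (P k) (f k))) = topspace (subtopology Z ?Y)"
  proof (rule Menger_game[OF Menger, where I = "\<lambda>D. finite D \<and> D \<subseteq> A" and nxt = extend
        and G = "\<lambda>k D i. ?Y \<inter> nbhds (extend k D i)" and ?s0.0 = "{}"])
    show "openin (subtopology Z ?Y) (?Y \<inter> nbhds (extend k D i))" if "finite D \<and> D \<subseteq> A" for k D i
    proof (rule openin_subtopology_Int2)
      show "openin Z (nbhds (extend k D i))"
        unfolding nbhds_def using extend_facts[OF that] AX opn by (intro openin_Union) blast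
    qed
    show "?Y \<inter> nbhds (extend k D i) \<subseteq> ?Y \<inter> nbhds (extend k D j)" if "i \<le> j" for k D i j
      using that by (auto simp: extend_def nbhds_def)
    show "(\<Union>i. ?Y \<inter> nbhds (extend k D i)) = topspace (subtopology Z ?Y)" if D: "finite D \<and> D \<subseteq> A" for k D
    proof -
      have "nbhds D \<union> nbhds (A - nbhds D) \<subseteq> (\<Union>i. nbhds (extend k D i))"
        by (auto simp: extend_def nbhds_def)
      then have "?Y \<subseteq> (\<Union>i. nbhds (extend k D i))"
        using covered_by_reflecting_set[of D] D YX by blast
      then show ?thesis using YX top by auto
    qed
  qed (use extend_facts in simp_all)
  then obtain P f where P0: "P 0 = {}" and PSuc': "\<forall>k. P (Suc k) = extend k (P k) (f k)"
    and cov: "(\<Union>k. ?Y \<inter> nbhds (extend k (P k) (f k))) = topspace (subtopology Z ?Y)"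
    by (elim exE conjE) (rule that)
  have PSuc: "P (Suc k) = extend k (P k) (f k)" for k using PSuc' by blast
  have PA: "finite (P k) \<and> P k \<subseteq> A" for k
    by (induction k) (simp_all add: P0 PSuc extend_facts)
  have Pmono: "P k \<subseteq> P (Suc k)" for k by (auto simp: PSuc extend_def)
  have Pmono': "P k \<subseteq> P l" if "k \<le> l" for k l using lift_Suc_mono_le[of P k l] Pmono that by simp
  let ?W = "\<Union>k. nbhds (P k)"
  have "countable (of_type (fst t) (snd t) - ?W)" if t: "t \<in> trace_type ` (X - ?W)" for t
  proof -
    obtain z where z: "z \<in> X - ?W" "t = trace_type z" using t by blast
    obtain S n Q where \<tau>: "ptype (trace z) z = (S, n, Q)" by (cases "ptype (trace z) z")
    \<comment> \<open>The type \<open>t\<close> is served from stage \<open>m\<close> on, and the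
      point chosen at stage \<open>m + i\<close> enters at stage \<open>Suc (m + i)\<close>.\<close>
    define m where "m = to_nat_on (trace_type ` X) t"
    have "\<exists>x. x \<in> P (Suc (m + i)) \<and> x \<in> candidates t (P (m + i))" for i
    proof -
      have "candidates t (P (m + i)) \<noteq> {}"
      proof -
        have "finite (\<Union>(F ` P (m + i)))" "\<Union>(F ` P (m + i)) \<subseteq> \<Union>(F ` A)"
          using PA[of "m + i"] F AX by auto
        then have "\<exists>x\<in>A. x \<in> of_type (trace z) (ptype (trace z) z) - nbhds (P (m + i)) \<and>
            disjnt (F x - trace z) (\<Union>(F ` P (m + i)))"
          using PA[of "m + i"] z(1) by (intro ex_catch) blast+
        then show ?thesis
          unfolding candidates_def z(2) trace_type_def fst_conv snd_conv by blast
      qed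
      moreover from this have "(SOME x. x \<in> candidates t (P (m + i))) \<in> serve (m + i) (P (m + i))"
        unfolding serve_def using t by (intro imageI) (auto simp: m_def)
      ultimately show ?thesis using some_candidate unfolding PSuc extend_def by blast
    qed
    then obtain q where q: "\<And>i. q i \<in> P (Suc (m + i))" "\<And>i. q i \<in> candidates t (P (m + i))" by metis
    have qT: "q i \<in> of_type (trace z) (S, n, Q)" for i
      using q(2)[of i] unfolding candidates_def z(2) trace_type_def \<tau> by simp
    have qW: "nbhd (q i) \<subseteq> ?W" for i using q(1)[of i] unfolding nbhds_def by blast
    \<comment> \<open>With an empty remainder a single served point would already cover
      \<open>z\<close>.\<close>
    have "n \<noteq> 0"
    proof
      assume "n = 0"
      then have "z \<in> nbhd (q 0)"
        using mem_nbhd_if_same_type qT[of 0] trace_type_facts(5)[of z] z(1) unfolding \<tau> by blast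
      then show False using qW z(1) by blast
    qed
    moreover have "disjnt (F (q j) - trace z) (F (q i))" if "i < j" for i j
    proof -
      \<comment> \<open>For \<open>i < j\<close> the earlier point has entered by stage
        \<open>m + j\<close>, so its support is among those that the candidate \<open>q j\<close>
        must avoid.\<close>
      have "q i \<in> P (m + j)" using q(1)[of i] Pmono'[of "Suc (m + i)" "m + j"] that by auto
      moreover have "disjnt (F (q j) - trace z) (\<Union>(F ` P (m + j)))"
        using q(2)[of j] unfolding candidates_def z(2) trace_type_def by simp
      ultimately show ?thesis by (auto simp: disjnt_def)
    qed
    ultimately have "countable (of_type (trace z) (S, n, Q) - nbhds (range q))"
      by (intro countable_of_type_minus_nbhds qT)
    then have "countable (of_type (trace z) (S, n, Q) - ?W)"
      by (rule countable_subset[rotated]) (use qW in \<open>auto simp: nbhds_def\<close>)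
    then show ?thesis unfolding z(2) trace_type_def \<tau> by simp
  qed
  moreover have "countable (trace_type ` (X - ?W))"
    using countable_trace_types by (rule countable_subset[rotated]) blast
  ultimately have "countable (\<Union>t\<in>trace_type ` (X - ?W). of_type (fst t) (snd t) - ?W)" by (intro countable_UN)
  moreover have "X - ?W \<subseteq> (\<Union>t\<in>trace_type ` (X - ?W). of_type (fst t) (snd t) - ?W)"
    using trace_type_facts(5) by (force simp: trace_type_def)
  ultimately have "countable (X - ?W)" by (rule countable_subset[rotated])
  moreover have "(P (Suc k) - P k) \<inter> nbhds (P k) = {}" for k
    using serve_subset[of k "P k"] unfolding PSuc extend_def by blast
  moreover have "?Y \<subseteq> ?W"
  proof -
    have "topspace (subtopology Z ?Y) = ?Y" using YX unfolding topspace_subtopology top by blast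
    then have "?Y \<subseteq> (\<Union>k. nbhds (P (Suc k)))" using cov unfolding PSuc[symmetric] by blast
    then show ?thesis by blast
  qed
  ultimately show ?thesis using PA Pmono by (intro exI[of _ P]) simp
qed

end

section \<open>Cylinders in the cube\<close>

lemma ex_finite_support:
  assumes W: "openin (subtopology (two_cube r) X) W" and "x \<in> W" and X: "X \<subseteq> topspace (two_cube r)"
  shows "\<exists>H. finite H \<and> H \<subseteq> Field r \<and> {y \<in> X. \<forall>\<alpha>\<in>H. y \<alpha> = x \<alpha>} \<subseteq> W"
proof -
  obtain W' where W': "openin (two_cube r) W'" "W = W' \<inter> X" using W unfolding openin_subtopology by blast
  then obtain V where V: "finite {i \<in> Field r. V i \<noteq> UNIV}" "x \<in> Pi\<^sub>E (Field r) V" "Pi\<^sub>E (Field r) V \<subseteq> W'"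
    using \<open>x \<in> W\<close> unfolding two_cube_def openin_product_topology_alt by auto
  let ?H = "{i \<in> Field r. V i \<noteq> UNIV}"
  have "{y \<in> X. \<forall>\<alpha>\<in>?H. y \<alpha> = x \<alpha>} \<subseteq> Pi\<^sub>E (Field r) V \<inter> X"
  proof (rule subsetI, rule IntI, rule PiE_I)
    fix y i assume y: "y \<in> {y \<in> X. \<forall>\<alpha>\<in>?H. y \<alpha> = x \<alpha>}"
    then have "y \<in> Pi\<^sub>E (Field r) (\<lambda>_. UNIV)" using X by (auto simp: two_cube_def)
    then show "i \<notin> Field r \<Longrightarrow> y i = undefined" by (rule PiE_arb)
    show "y i \<in> V i" if "i \<in> Field r"
    proof (cases "V i = UNIV")
      case False
      then have "y i = x i" using y that by blast
      then show ?thesis using V(2) that by auto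
    qed simp
    show "y \<in> X" using y by blast
  qed
  also have "\<dots> \<subseteq> W" using V(3) W'(2) by blast
  finally have "{y \<in> X. \<forall>\<alpha>\<in>?H. y \<alpha> = x \<alpha>} \<subseteq> W" .
  then show ?thesis using V(1) by (intro exI[of _ ?H]) simp
qed

lemma openin_cylinder:
  assumes "finite H" "H \<subseteq> Field r" "X \<subseteq> topspace (two_cube r)"
  shows "openin (subtopology (two_cube r) X) {y \<in> X. \<forall>\<alpha>\<in>H. y \<alpha> = x \<alpha>}"
proof -
  have "openin (two_cube r) {y \<in> topspace (two_cube r). y \<alpha> \<in> {x \<alpha>}}" if "\<alpha> \<in> H" for \<alpha>
    unfolding two_cube_def
    by (rule openin_continuous_map_preimage[OF continuous_map_product_projection]) (use that assms(2) in auto)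
  then have "openin (two_cube r) ((\<Inter>\<alpha>\<in>H. {y \<in> topspace (two_cube r). y \<alpha> \<in> {x \<alpha>}}) \<inter> topspace (two_cube r))"
    by (intro openin_INT assms(1))
  moreover have "{y \<in> X. \<forall>\<alpha>\<in>H. y \<alpha> = x \<alpha>} =
      ((\<Inter>\<alpha>\<in>H. {y \<in> topspace (two_cube r). y \<alpha> \<in> {x \<alpha>}}) \<inter> topspace (two_cube r)) \<inter> X"
    using assms(3) by auto
  ultimately show ?thesis unfolding openin_subtopology by blast
qed

lemma t1_space_subtopology_two_cube: "t1_space (subtopology (two_cube r) X)"
  unfolding two_cube_def
  by (intro Hausdorff_imp_t1_space Hausdorff_space_subtopology)
    (simp add: Hausdorff_space_product_topology)

section \<open>Assembling the closed discrete set\<close>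

theorem theorem7:
  fixes r :: "'l rel" and X :: "('l \<Rightarrow> bool) set"
  assumes "Card_order r" and "uncountable (Field r)"
    and "X \<subseteq> topspace (two_cube r)"
    and "HFC r X"
    and "\<And>A. A \<subseteq> X \<Longrightarrow> countable A \<Longrightarrow>
           Menger_space (subtopology (subtopology (two_cube r) X)
             (subtopology (two_cube r) X closure_of A))"
  shows "D_space (subtopology (two_cube r) X)"
  unfolding D_space_def
proof (intro allI impI)
  let ?Z = "subtopology (two_cube r) X"
  have top: "topspace ?Z = X" using assms(3) by auto
  fix U assume U: "nbhd_assignment ?Z U"
  \<comment> \<open>Each assigned neighbourhood contains a cylinder about its point, so a set whose
    cylinders cover \<open>X\<close> also works for \<open>U\<close>.\<close>
  have "\<forall>x\<in>X. \<exists>H. finite H \<and> H \<subseteq> Field r \<and> {y \<in> X. \<forall>\<alpha>\<in>H. y \<alpha> = x \<alpha>} \<subseteq> U x"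
    using U ex_finite_support[OF _ _ assms(3)] unfolding nbhd_assignment_def top by blast
  from bchoice[OF this] obtain F where F_all: "\<forall>x\<in>X. finite (F x) \<and> F x \<subseteq> Field r \<and>
      {y \<in> X. \<forall>\<alpha>\<in>F x. y \<alpha> = x \<alpha>} \<subseteq> U x" ..
  then have F: "finite (F x) \<and> F x \<subseteq> Field r"
    and FU: "{y \<in> X. \<forall>\<alpha>\<in>F x. y \<alpha> = x \<alpha>} \<subseteq> U x" if "x \<in> X" for x
    using that by simp_all
  interpret hfc_assignment r X F
    using assms(1,4) F by unfold_locales (auto simp: card_order_on_well_order_on)
  obtain A where A: "countable A" "A \<subseteq> X" "reflecting A"
    using ex_reflecting_set by blast
  interpret hfc_reflecting r X F A
    using A by unfold_locales
  have opn: "openin ?Z (nbhd x)" if "x \<in> X" for x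
    unfolding nbhd_def using openin_cylinder F[OF that] assms(3) by blast
  have "\<exists>P :: nat \<Rightarrow> ('l \<Rightarrow> bool) set.
    (\<forall>k. finite (P k) \<and> P k \<subseteq> A \<and> P k \<subseteq> P (Suc k) \<and> (P (Suc k) - P k) \<inter> nbhds (P k) = {}) \<and>
    ?Z closure_of A \<subseteq> (\<Union>k. nbhds (P k)) \<and> countable (X - (\<Union>k. nbhds (P k)))"
    by (rule ex_covering_chain[OF top opn assms(5)[OF A(2,1)]])
  then obtain P :: "nat \<Rightarrow> ('l \<Rightarrow> bool) set" where
    P': "\<forall>k. finite (P k) \<and> P k \<subseteq> A \<and> P k \<subseteq> P (Suc k) \<and> (P (Suc k) - P k) \<inter> nbhds (P k) = {}"
    and cover: "?Z closure_of A \<subseteq> (\<Union>k. nbhds (P k))" and rest: "countable (X - (\<Union>k. nbhds (P k)))"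
    by (elim exE conjE) (rule that)
  have P: "finite (P k)" "P k \<subseteq> A" "P k \<subseteq> P (Suc k)" "(P (Suc k) - P k) \<inter> nbhds (P k) = {}" for k
    using P' by simp_all
  let ?W = "\<Union>k. nbhds (P k)"
  have "openin ?Z (nbhds (P k))" for k
    unfolding nbhds_def using opn P(2) A(2) by (intro openin_Union) blast
  then have "openin ?Z ?W" by blast
  \<comment> \<open>What the chain leaves uncovered is closed and countable, so the greedy selection
    applies to it.\<close>
  then have "closedin ?Z (X - ?W)" using top by (metis closedin_diff closedin_topspace)
  then have "\<exists>B. B \<subseteq> X - ?W \<and> X - ?W \<subseteq> (\<Union>x\<in>B. nbhd x) \<and>
      (\<forall>y\<in>topspace ?Z. \<exists>O'. openin ?Z O' \<and> y \<in> O' \<and> finite (B \<inter> O'))"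
    by (intro countable_closed_locally_finite) (use opn nbhd_self rest top in simp_all)
  then obtain B where B: "B \<subseteq> X - ?W" "X - ?W \<subseteq> (\<Union>x\<in>B. nbhd x)"
    "\<forall>y\<in>topspace ?Z. \<exists>O'. openin ?Z O' \<and> y \<in> O' \<and> finite (B \<inter> O')"
    by (elim exE conjE) (rule that)
  let ?D = "(\<Union>k. P k) \<union> B"
  have DX: "?D \<subseteq> X" using P(2) A(2) B(1) by blast
  have "\<exists>O'. openin ?Z O' \<and> y \<in> O' \<and> finite (?D \<inter> O')" if y: "y \<in> X" for y
  proof -
    \<comment> \<open>The closure of \<open>A\<close> serves as the closed set that contains the
      chain and is covered by it.\<close>
    have "\<exists>O'. openin ?Z O' \<and> y \<in> O' \<and> finite ((\<Union>k. P k) \<inter> O')"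
    proof (rule locally_finite_Union_chain[where U = nbhd and C = "?Z closure_of A"])
      show "(\<Union>k. P k) \<subseteq> ?Z closure_of A"
        using P(2) closure_of_subset[of A ?Z] A(2) unfolding top by blast
      show "P k \<subseteq> topspace ?Z" for k using P(2) A(2) unfolding top by blast
      show "y \<in> topspace ?Z" unfolding top by (rule y)
      show "openin ?Z (nbhd x)" if "x \<in> topspace ?Z" for x using that opn unfolding top by blast
    qed (use P(1,3) P(4)[unfolded nbhds_def] cover[unfolded nbhds_def] in simp_all)
    then obtain O1 where O1: "openin ?Z O1" "y \<in> O1" "finite ((\<Union>k. P k) \<inter> O1)" by blast
    obtain O2 where O2: "openin ?Z O2" "y \<in> O2" "finite (B \<inter> O2)" using B(3) y unfolding top by blast
    have "finite (?D \<inter> (O1 \<inter> O2))"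
      by (rule finite_subset[OF _ finite_UnI[OF O1(3) O2(3)]]) blast
    then show ?thesis using O1 O2 openin_Int by blast
  qed
  then have "closedin ?Z ?D" "subtopology ?Z ?D = discrete_topology ?D"
    using closed_discrete_if_locally_finite[OF t1_space_subtopology_two_cube, of ?D r X] DX
    unfolding top by blast+
  moreover have "(\<Union>x\<in>?D. U x) = topspace ?Z"
  proof
    show "(\<Union>x\<in>?D. U x) \<subseteq> topspace ?Z"
    proof (rule UN_least)
      fix x assume "x \<in> ?D"
      then have "openin ?Z (U x)" using U DX unfolding nbhd_assignment_def top by blast
      then show "U x \<subseteq> topspace ?Z" by (rule openin_subset)
    qed
    have "X \<subseteq> (\<Union>x\<in>?D. nbhd x)" using B(2) unfolding nbhds_def by blast
    also have "\<dots> \<subseteq> (\<Union>x\<in>?D. U x)" using FU DX unfolding nbhd_def by blast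
    finally show "topspace ?Z \<subseteq> (\<Union>x\<in>?D. U x)" unfolding top .
  qed
  ultimately show "\<exists>D. closedin ?Z D \<and> subtopology ?Z D = discrete_topology D \<and> (\<Union>x\<in>D. U x) = topspace ?Z"
    by blast
qed

end
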